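(* If $G_1$ and $G_2$ are cospectral for the $L^{(q)}$ matrix with $S=B_1\oplus \cdots\oplus B_\ell$ as a similarity matrix, then for the similarity vertex partitioning $V_1,\ldots,V_\ell$ the graphs $\displaystyle G_1\circ_{i=1}^\ell{}_{V_i}H_i$ and $\displaystyle G_2\circ_{i=1}^\ell{}_{V_i}H_i$ are cospectral for the $L^{(q)}$ matrix for any choice of $H_1,\ldots,H_\ell$.
   Context: All graphs are simple and undirected. For fixed $q$, the $q$-Laplacian $L^{(q)}_G$ has $(u,v)$ entry $q\deg_G(u)$ if $u=v$, $1$ if $u,v$ adjacent, $0$ otherwise (so $q=0,1,-1$ give the adjacency matrix, signless Laplacian, and negative Laplacian). $G_1$ and $G_2$ have the same vertex set labeling; $S$ is an invertible block diagonal matrix $B_1\oplus\cdots\oplus B_\ell$ with $S L^{(q)}_{G_1}S^{-1}=L^{(q)}_{G_2}$, and the similarity vertex partitioning $V_1,\ldots,V_\ell$ assigns to $V_i$ the vertices indexing the rows of block $B_i$. Given rooted graphs $H_1,\ldots,H_\ell$, $\displaystyle G\circ_{i=1}^\ell{}_{V_i}H_i$ denotes the graph obtained from the disjoint union of $G$ and, for each $i$ and each $v\in V_i$, a separate copy of $H_i$, by identifying the root of that copy of $H_i$ with $v$. *)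

theory Defs
  imports
    "Jordan_Normal_Form.Char_Poly"
    "Graph_Theory.Pair_Digraph"
begin

text \<open>
  Finite simple undirected graphs are \<open>pair_graph\<close>s: finite vertex set, symmetric and irreflexive
  set of arcs.  Thus \<open>out_degree\<close> is the degree of a vertex.  The rows and columns of the
  \<open>q\<close>-Laplacian are ordered by a list \<open>vs\<close> enumerating the vertices.
\<close>

definition enumerates :: "'a list \<Rightarrow> 'a set \<Rightarrow> bool" where
  "enumerates vs V \<longleftrightarrow> distinct vs \<and> set vs = V"

definition q_laplacian :: "real \<Rightarrow> 'a list \<Rightarrow> 'a pair_pre_digraph \<Rightarrow> complex mat" where
  "q_laplacian q vs G = mat (length vs) (length vs) (\<lambda>(i, j).
     if i = j then complex_of_real q * of_nat (out_degree (with_proj G) (vs ! i))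
     else if (vs ! i, vs ! j) \<in> parcs G then 1 else 0)"

text \<open>The multiset of eigenvalues, with algebraic multiplicities.\<close>

definition eigenvalue_mset :: "complex mat \<Rightarrow> complex multiset" where
  "eigenvalue_mset A = proots (char_poly A)"

text \<open>
  The enumeration chosen here is irrelevant, see \<open>q_spectrum_eq\<close> below.
\<close>

definition q_spectrum :: "real \<Rightarrow> 'a pair_pre_digraph \<Rightarrow> complex multiset" where
  "q_spectrum q G = eigenvalue_mset (q_laplacian q (SOME vs. enumerates vs (pverts G)) G)"

definition cospectral :: "real \<Rightarrow> 'a pair_pre_digraph \<Rightarrow> 'b pair_pre_digraph \<Rightarrow> bool" where
  "cospectral q G H \<longleftrightarrow> q_spectrum q G = q_spectrum q H"

text \<open>
  The vertices indexing the rows of the \<open>i\<close>-th block (counted from 0) of \<open>diag_block_mat Bs\<close>.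
\<close>

definition similarity_part :: "'a list \<Rightarrow> complex mat list \<Rightarrow> nat \<Rightarrow> 'a set" where
  "similarity_part vs Bs i =
     set (take (dim_row (Bs ! i)) (drop (\<Sum>k<i. dim_row (Bs ! k)) vs))"

definition rooted_graph :: "'h pair_pre_digraph \<Rightarrow> 'h \<Rightarrow> bool" where
  "rooted_graph H r \<longleftrightarrow> pair_graph H \<and> r \<in> pverts H"

text \<open>
  \<open>rooted_product G l V H r\<close> attaches to every vertex \<open>v \<in> V i\<close> (\<open>i < l\<close>) of \<open>G\<close> its own copy of
  \<open>H i\<close> with root \<open>r i\<close>.  The pair \<open>(v, x)\<close> is the vertex \<open>x\<close> of the copy attached to \<open>v\<close>; in
  particular \<open>(v, r i)\<close> is the root of that copy, identified with the vertex \<open>v\<close> of \<open>G\<close>.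
  The sets \<open>V i\<close> are meant to partition the vertices of \<open>G\<close>.
\<close>

definition rooted_product ::
    "'a pair_pre_digraph \<Rightarrow> nat \<Rightarrow> (nat \<Rightarrow> 'a set) \<Rightarrow> (nat \<Rightarrow> 'h pair_pre_digraph) \<Rightarrow> (nat \<Rightarrow> 'h)
      \<Rightarrow> ('a \<times> 'h) pair_pre_digraph" where
  "rooted_product G l V H r = \<lparr>
     pverts = {(v, x) | v x i. i < l \<and> v \<in> V i \<and> x \<in> pverts (H i)},
     parcs = {((v, r i), (w, r j)) | v w i j. i < l \<and> j < l \<and> v \<in> V i \<and> w \<in> V j \<and> (v, w) \<in> parcs G}
           \<union> {((v, x), (v, y)) | v x y i. i < l \<and> v \<in> V i \<and> (x, y) \<in> parcs (H i)} \<rparr>"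

lemma q_laplacian_enumeration_similar:
  assumes "enumerates vs V" "enumerates ws V"
  shows "similar_mat (q_laplacian q vs G) (q_laplacian q ws G)"
proof -
  define n where "n = length vs"
  have d: "distinct vs" "distinct ws" "set vs = set ws" and lv: "length vs = n"
    and lw: "length ws = n"
    using assms by (auto simp: enumerates_def n_def distinct_card[symmetric])
  define M where "M = (\<lambda>u v. if u = v then complex_of_real q * of_nat (out_degree (with_proj G) u)
     else if (u, v) \<in> parcs G then 1 else 0)"
  have L: "q_laplacian q xs G = mat n n (\<lambda>(i, j). M (xs ! i) (xs ! j))"
    if "distinct xs" "length xs = n" for xs
    using that by (auto simp: q_laplacian_def M_def nth_eq_iff_index_eq intro!: eq_matI)
  define p where "p = (\<lambda>i. SOME k. k < n \<and> ws ! k = vs ! i)"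
  have p: "p i < n \<and> ws ! p i = vs ! i" if "i < n" for i
    unfolding p_def
    by (rule someI_ex) (metis that d(3) in_set_conv_nth lv lw nth_mem)
  have peq: "vs ! i = ws ! k \<longleftrightarrow> k = p i" if "i < n" "k < n" for i k
    using p[OF that(1)] that d(2) lw by (metis nth_eq_iff_index_eq)
  define s where "s = (\<lambda>k. SOME i. i < n \<and> vs ! i = ws ! k)"
  have s: "s k < n \<and> vs ! s k = ws ! k" if "k < n" for k
    unfolding s_def
    by (rule someI_ex) (metis that d(3) in_set_conv_nth lv lw nth_mem)
  have seq: "vs ! i = ws ! k \<longleftrightarrow> i = s k" if "i < n" "k < n" for i k
    using s[OF that(2)] that d(1) lv by (metis nth_eq_iff_index_eq)
  have sp: "s k = i \<longleftrightarrow> p i = k" if "i < n" "k < n" for i k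
    using peq[OF that] seq[OF that] by metis
  define P where "P = mat n n (\<lambda>(i, k). if k = p i then 1 else 0 :: complex)"
  define Q where "Q = mat n n (\<lambda>(k, i). if k = p i then 1 else 0 :: complex)"
  have Q_alt: "Q = mat n n (\<lambda>(k, i). if i = s k then 1 else 0)"
    unfolding Q_def by (rule cong_mat) (simp_all add: eq_commute[of _ "p _"] eq_commute[of _ "s _"] sp)
  have pn: "p i < n" if "i < n" for i
    using p[OF that] by blast
  have sn: "s k < n" if "k < n" for k
    using s[OF that] by blast
  have ps: "p (s k) = k" if "k < n" for k
    using sp[OF sn[OF that] that] by blast
  have inj: "p i = p j \<longleftrightarrow> i = j" if "i < n" "j < n" for i j
    using sp[OF that(1) pn[OF that(2)]] sp[OF that(2) pn[OF that(2)]] by auto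
  have wp: "ws ! p i = vs ! i" if "i < n" for i
    using p[OF that] by blast
  have carr: "P \<in> carrier_mat n n" "Q \<in> carrier_mat n n" by (auto simp: P_def Q_def)
  have delta: "(\<Sum>k = 0..<n. (if k = a then 1 else 0) * f k) = (f a :: complex)"
    "(\<Sum>k = 0..<n. f k * (if k = a then 1 else 0)) = (f a :: complex)" if "a < n" for a f
    using that by (simp_all add: if_distrib[where f="\<lambda>x. _ * x"] if_distrib[where f="\<lambda>x. x * _"]
        cong: if_cong)
  have PQ: "P * Q = 1\<^sub>m n"
    by (rule eq_matI) (auto simp: P_def Q_def scalar_prod_def pn delta inj)
  have QP: "Q * P = 1\<^sub>m n"
    unfolding Q_alt P_def
    by (rule eq_matI) (auto simp: scalar_prod_def sn delta ps)
  have PB: "P * q_laplacian q ws G = mat n n (\<lambda>(i, j). M (vs ! i) (ws ! j))"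
    unfolding L[OF d(2) lw]
    by (rule eq_matI) (auto simp: P_def scalar_prod_def pn delta wp)
  have "P * q_laplacian q ws G * Q = q_laplacian q vs G"
    unfolding PB unfolding L[OF d(1) lv]
    by (rule eq_matI) (auto simp: Q_def scalar_prod_def pn delta wp)
  then have "similar_mat_wit (q_laplacian q vs G) (q_laplacian q ws G) P Q"
    using carr PQ QP lv lw by (auto simp: similar_mat_wit_def Let_def q_laplacian_def)
  then show ?thesis unfolding similar_mat_def by blast
qed

lemma q_spectrum_eq:
  assumes "enumerates vs (pverts G)"
  shows "q_spectrum q G = eigenvalue_mset (q_laplacian q vs G)"
proof -
  have "enumerates (SOME vs. enumerates vs (pverts G)) (pverts G)"
    using assms by (rule someI)
  from char_poly_similar[OF q_laplacian_enumeration_similar[OF this assms]]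
  show ?thesis by (simp add: q_spectrum_def eigenvalue_mset_def)
qed

lemma similar_imp_cospectral:
  assumes "enumerates vs (pverts G)" "enumerates ws (pverts H)"
    and "similar_mat (q_laplacian q vs G) (q_laplacian q ws H)"
  shows "cospectral q G H"
  using char_poly_similar[OF assms(3)]
  by (simp add: cospectral_def q_spectrum_eq[OF assms(1)] q_spectrum_eq[OF assms(2)]
      eigenvalue_mset_def)

lemma similarity_part_nth:
  assumes "i < length Bs" "length vs = (\<Sum>k<length Bs. dim_row (Bs ! k))"
  shows "similarity_part vs Bs i = {vs ! ((\<Sum>k<i. dim_row (Bs ! k)) + t) | t. t < dim_row (Bs ! i)}"
proof -
  have "(\<Sum>k<Suc i. dim_row (Bs ! k)) \<le> length vs"
    unfolding assms(2) by (rule sum_mono2) (use assms(1) in auto)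
  then have "(\<Sum>k<i. dim_row (Bs ! k)) + dim_row (Bs ! i) \<le> length vs"
    by simp
  then show ?thesis
    unfolding similarity_part_def set_conv_nth
    by (intro Collect_cong ex_cong1) (auto simp: min_def)
qed

lemma pair_graph_rooted_product:
  assumes "pair_graph G" "\<And>i. i < l \<Longrightarrow> rooted_graph (H i) (r i)"
    and "pverts G = (\<Union>i<l. V i)"
  shows "pair_graph (rooted_product G l V H r)"
proof -
  interpret G: pair_graph G by fact
  have H: "pair_graph (H i)" "r i \<in> pverts (H i)" if "i < l" for i
    using assms(2)[OF that] by (auto simp: rooted_graph_def)
  let ?P = "rooted_product G l V H r"
  have vH: "x \<in> pverts (H i) \<and> y \<in> pverts (H i)" if "i < l" "(x, y) \<in> parcs (H i)" for i x y
    using pair_wf_digraph.arc_fst_in_verts[of "H i" "(x, y)"]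
      pair_wf_digraph.arc_snd_in_verts[of "H i" "(x, y)"] H(1)[OF that(1)] that(2)
    by (auto simp: pair_graph_def pair_digraph_def pair_fin_digraph_def)
  have PI: "(v, x) \<in> pverts ?P" if "i < l" "v \<in> V i" "x \<in> pverts (H i)" for v x i
    using that unfolding rooted_product_def by auto
  have PE: thesis if "e \<in> parcs ?P"
    and "\<And>v w i j. e = ((v, r i), (w, r j)) \<Longrightarrow> i < l \<Longrightarrow> j < l \<Longrightarrow> v \<in> V i \<Longrightarrow> w \<in> V j \<Longrightarrow>
           (v, w) \<in> parcs G \<Longrightarrow> thesis"
    and "\<And>v x y i. e = ((v, x), (v, y)) \<Longrightarrow> i < l \<Longrightarrow> v \<in> V i \<Longrightarrow> (x, y) \<in> parcs (H i) \<Longrightarrow> thesis"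
    for e thesis
    using that(1) unfolding rooted_product_def by (auto intro: that(2,3))
  have sub: "fst e \<in> pverts ?P \<and> snd e \<in> pverts ?P" if "e \<in> parcs ?P" for e
    using that by (rule PE) (simp_all add: PI H(2) vH)
  have wf: "pair_wf_digraph ?P"
    by unfold_locales (use sub in auto)
  have "pverts ?P \<subseteq> (\<Union>i<l. V i \<times> pverts (H i))"
    by (auto simp: rooted_product_def)
  moreover have "finite (V i)" if "i < l" for i
    using G.pair_finite_verts that unfolding assms(3) by (auto intro: finite_subset)
  moreover have "finite (pverts (H i))" if "i < l" for i
    using H(1)[OF that] pair_fin_digraph.pair_finite_verts
    by (auto simp: pair_graph_def pair_digraph_def)
  ultimately have fv: "finite (pverts ?P)"
    by (meson finite_SigmaI finite_UN_I finite_lessThan finite_subset lessThan_iff)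
  have "parcs ?P \<subseteq> pverts ?P \<times> pverts ?P"
    using sub by (auto simp: mem_Times_iff)
  then have fa: "finite (parcs ?P)"
    using fv by (meson finite_SigmaI finite_subset)
  have symH: "(y, x) \<in> parcs (H i)" if "i < l" "(x, y) \<in> parcs (H i)" for i x y
    using pair_sym_digraph.pair_sym_arcs[of "H i"] H(1)[OF that(1)] that(2)
    by (auto simp: pair_graph_def pair_pseudo_graph_def symmetric_def sym_def)
  have symG: "(y, x) \<in> parcs G" if "(x, y) \<in> parcs G" for x y
    using G.pair_sym_arcs that by (auto simp: symmetric_def sym_def)
  have "(b, a) \<in> parcs ?P" if "(a, b) \<in> parcs ?P" for a b
    using that symH symG unfolding rooted_product_def by simp blast
  then have sy: "symmetric (with_proj ?P)"
    unfolding symmetric_def by (auto intro: symI)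
  have irrH: "x \<noteq> y" if "i < l" "(x, y) \<in> parcs (H i)" for i x y
    using pair_loopfree_digraph.pair_no_loops[of "H i" "(x, y)"] H(1)[OF that(1)] that(2)
    by (auto simp: pair_graph_def pair_digraph_def)
  have irrG: "x \<noteq> y" if "(x, y) \<in> parcs G" for x y
    using G.pair_no_loops[OF that] by simp
  have lf: "fst e \<noteq> snd e" if "e \<in> parcs ?P" for e
    using that by (auto simp: rooted_product_def dest: irrH irrG)
  interpret pair_wf_digraph ?P by (rule wf)
  show ?thesis
    by unfold_locales (use fv fa sy lf in auto)
qed

end

theory Submission
  imports Defs
begin

text \<open>
  Let \<open>S\<close> intertwine the two \<open>q\<close>-Laplacians.  Copying the entry \<open>S v w\<close> along the pairs
  \<open>((v, x), (w, x))\<close> gives a matrix that intertwines the \<open>q\<close>-Laplacians of the rooted products: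
  such a Laplacian is the sum of a copy of the Laplacian of \<open>G\<close> on the roots and of a copy of
  the Laplacian of \<open>H i\<close> for every \<open>v \<in> V i\<close>.  The first summand is respected since \<open>S\<close>
  intertwines and maps the roots of the copies of \<open>H i\<close> to roots of copies of \<open>H i\<close>, the second
  one since \<open>S\<close> only mixes vertices with the same attached graph.
\<close>

section \<open>Matrices indexed by vertices\<close>

text \<open>Entries depend on vertices instead of positions, so that matrix identities become
  identities of sums over the vertex set.\<close>

definition list_mat :: "'a list \<Rightarrow> ('a \<Rightarrow> 'a \<Rightarrow> complex) \<Rightarrow> complex mat" where
  "list_mat vs f = mat (length vs) (length vs) (\<lambda>(i, j). f (vs ! i) (vs ! j))"

lemma list_mat_carrier [simp]: "list_mat vs f \<in> carrier_mat (length vs) (length vs)"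
  by (simp add: list_mat_def)

lemma list_mat_eq_iff:
  "list_mat vs f = list_mat vs g \<longleftrightarrow> (\<forall>u \<in> set vs. \<forall>w \<in> set vs. f u w = g u w)"
  by (fastforce simp: list_mat_def mat_eq_iff in_set_conv_nth)

lemma list_mat_mult:
  assumes "distinct vs"
  shows "list_mat vs f * list_mat vs g = list_mat vs (\<lambda>u w. \<Sum>v\<in>set vs. f u v * g v w)"
proof -
  have "(\<Sum>k = 0..<length vs. h (vs ! k)) = (\<Sum>v\<in>set vs. h v)" for h :: "'a \<Rightarrow> complex"
    using assms by (intro sum.reindex_bij_betw bij_betw_nth) (auto simp: atLeast0LessThan)
  then show ?thesis
    by (intro eq_matI) (auto simp: list_mat_def scalar_prod_def)
qed

lemma list_mat_one:
  assumes "distinct vs"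
  shows "1\<^sub>m (length vs) = list_mat vs (\<lambda>u w. if u = w then 1 else 0)"
  using assms by (intro eq_matI) (auto simp: list_mat_def nth_eq_iff_index_eq)

text \<open>In a distinct list a vertex determines its position, so an entry may be looked up by its
  two vertices.\<close>

lemma list_mat_exists:
  assumes "distinct vs" "A \<in> carrier_mat (length vs) (length vs)"
  obtains f where "A = list_mat vs f"
proof
  have "(THE k. k < length vs \<and> vs ! k = vs ! i) = i" if "i < length vs" for i
    using that assms(1) by (auto simp: nth_eq_iff_index_eq)
  then show "A = list_mat vs (\<lambda>u w. A $$ (THE k. k < length vs \<and> vs ! k = u,
                                        THE k. k < length vs \<and> vs ! k = w))"
    using assms(2) by (intro eq_matI) (auto simp: list_mat_def)
qed

definition lap :: "real \<Rightarrow> 'a pair_pre_digraph \<Rightarrow> 'a \<Rightarrow> 'a \<Rightarrow> complex" where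
  "lap q G u w = (if u = w then complex_of_real q * of_nat (out_degree (with_proj G) u)
     else if (u, w) \<in> parcs G then 1 else 0)"

lemma q_laplacian_eq_list_mat:
  assumes "distinct vs"
  shows "q_laplacian q vs G = list_mat vs (lap q G)"
  using assms
  by (intro eq_matI) (auto simp: q_laplacian_def list_mat_def lap_def nth_eq_iff_index_eq)

text \<open>For square matrices the right inverse \<open>T\<close> of \<open>S\<close> is also a
  left inverse, so the intertwining relation becomes the similarity
  \<open>?L' = ?S * ?L * ?T\<close>. The spectrum does not depend on the enumeration, so any one of
  \<open>V\<close> will do.\<close>

lemma cospectral_intertwining:
  assumes "finite V" "pverts G = V" "pverts G' = V"
    and "\<And>u w. u \<in> V \<Longrightarrow> w \<in> V \<Longrightarrow>
           (\<Sum>v\<in>V. S u v * lap q G v w) = (\<Sum>v\<in>V. lap q G' u v * S v w)"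
    and "\<And>u w. u \<in> V \<Longrightarrow> w \<in> V \<Longrightarrow> (\<Sum>v\<in>V. S u v * T v w) = (if u = w then 1 else 0)"
  shows "cospectral q G G'"
proof -
  obtain vs where vs: "distinct vs" "set vs = V"
    using finite_distinct_list[OF assms(1)] by blast
  define n where "n = length vs"
  let ?L = "list_mat vs (lap q G)" and ?L' = "list_mat vs (lap q G')"
  let ?S = "list_mat vs S" and ?T = "list_mat vs T"
  have carr: "list_mat vs f \<in> carrier_mat n n" for f
    by (simp add: n_def)
  have ST: "?S * ?T = 1\<^sub>m n"
    using assms(5) vs by (simp add: list_mat_mult list_mat_one list_mat_eq_iff n_def)
  then have TS: "?T * ?S = 1\<^sub>m n"
    by (rule mat_mult_left_right_inverse[OF carr carr])
  have SL: "?S * ?L = ?L' * ?S"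
    using assms(4) vs by (simp add: list_mat_mult list_mat_eq_iff)
  have "?S * ?L * ?T = ?L' * (?S * ?T)"
    unfolding SL by (rule assoc_mult_mat[OF carr carr carr])
  then have "?L' = ?S * ?L * ?T"
    using carr[of "lap q G'"] ST by simp
  then have "similar_mat ?L' ?L"
    using similar_mat_witI[OF ST TS _ carr carr carr carr] by (auto simp: similar_mat_def)
  then have "cospectral q G' G"
    using similar_imp_cospectral[of vs G' vs G q] vs assms(2,3)
    by (simp add: enumerates_def q_laplacian_eq_list_mat)
  then show ?thesis
    by (simp add: cospectral_def)
qed

section \<open>The similarity partition and the blocks\<close>

lemma similarity_part_Cons_0: "similarity_part vs (B # Bs) 0 = set (take (dim_row B) vs)"
  by (simp add: similarity_part_def)

lemma similarity_part_Cons_Suc: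
  "similarity_part vs (B # Bs) (Suc i) = similarity_part (drop (dim_row B) vs) Bs i"
  by (simp add: similarity_part_def sum.lessThan_Suc_shift del: sum.lessThan_Suc)
     (simp add: add.commute)

lemmas similarity_part_Cons = similarity_part_Cons_0 similarity_part_Cons_Suc

lemma similarity_part_subset: "similarity_part vs Bs i \<subseteq> set vs"
  by (auto simp: similarity_part_def dest: in_set_takeD in_set_dropD)

text \<open>Induction on the blocks: the first part is an initial segment of \<open>vs\<close>,
  which distinctness separates from all later parts.\<close>

lemma similarity_part_partition:
  assumes "distinct vs" "length vs = sum_list (map dim_row Bs)" "v \<in> set vs"
  shows "\<exists>!i. i < length Bs \<and> v \<in> similarity_part vs Bs i"
  using assms
proof (induction Bs arbitrary: vs)
  case Nil
  then show ?case by simp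
next
  case (Cons B Bs)
  let ?us = "take (dim_row B) vs" and ?ws = "drop (dim_row B) vs"
  have disj: "set ?us \<inter> set ?ws = {}" and un: "set ?us \<union> set ?ws = set vs"
    using Cons.prems(1)
    by (metis append_take_drop_id distinct_append, metis append_take_drop_id set_append)
  show ?case
  proof (cases "v \<in> set ?us")
    case True
    then have "v \<notin> similarity_part ?ws Bs i" for i
      using disj similarity_part_subset by fast
    with True show ?thesis
      by (metis length_greater_0_conv list.distinct(1) not0_implies_Suc similarity_part_Cons)
  next
    case False
    then have "v \<in> set ?ws" using un Cons.prems(3) by blast
    then have "\<exists>!i. i < length Bs \<and> v \<in> similarity_part ?ws Bs i"
      using Cons.prems by (intro Cons.IH) auto
    then obtain i where i: "i < length Bs" "v \<in> similarity_part ?ws Bs i"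
      and uniq: "\<And>j. j < length Bs \<Longrightarrow> v \<in> similarity_part ?ws Bs j \<Longrightarrow> j = i" by blast
    show ?thesis
    proof (intro ex1I[of _ "Suc i"])
      fix j assume "j < length (B # Bs) \<and> v \<in> similarity_part vs (B # Bs) j"
      then show "j = Suc i"
        using False uniq by (cases j) (auto simp: similarity_part_Cons)
    qed (use i in \<open>simp add: similarity_part_Cons\<close>)
  qed
qed

text \<open>Entries outside the diagonal blocks vanish, so a nonzero entry has its row and its
  column in one block.\<close>

lemma diag_block_mat_nonzero_same_part:
  assumes "\<And>B. B \<in> set Bs \<Longrightarrow> square_mat B" "length vs = sum_list (map dim_row Bs)"
    and "a < length vs" "b < length vs" "diag_block_mat Bs $$ (a, b) \<noteq> 0"
  shows "\<exists>i < length Bs. vs ! a \<in> similarity_part vs Bs i \<and> vs ! b \<in> similarity_part vs Bs i"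
  using assms
proof (induction Bs arbitrary: vs a b)
  case Nil
  then show ?case by simp
next
  case (Cons B Bs)
  define m where "m = dim_row B"
  have "square_mat B" using Cons.prems(1) by simp
  then have cB: "dim_col B = m" by (simp add: m_def)
  have dims: "dim_row (diag_block_mat Bs) = sum_list (map dim_row Bs)"
    "dim_col (diag_block_mat Bs) = sum_list (map dim_row Bs)"
    using Cons.prems(1) by (induction Bs) (auto simp: Let_def dim_diag_block_mat)
  have len: "length vs = m + sum_list (map dim_row Bs)"
    using Cons.prems(2) by (simp add: m_def)
  \<comment> \<open>Since the blocks are square, rows and columns are both cut at \<open>m\<close>;
    past the first block both indices shift by \<open>m\<close>.\<close>
  have entry: "diag_block_mat (B # Bs) $$ (a, b) =
      (if a < m then if b < m then B $$ (a, b) else 0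
       else if b < m then 0 else diag_block_mat Bs $$ (a - m, b - m))"
    using Cons.prems(3,4) len by (simp add: Let_def dims cB m_def[symmetric])
  show ?case
  proof (cases "a < m")
    case True
    then have "b < m" using Cons.prems(5) entry by (auto split: if_splits)
    then have "vs ! a \<in> set (take m vs)" "vs ! b \<in> set (take m vs)"
      using True len by (auto simp: in_set_conv_nth)
    then show ?thesis
      by (intro exI[of _ 0]) (simp add: similarity_part_Cons m_def)
  next
    case False
    then have b: "\<not> b < m" and nz: "diag_block_mat Bs $$ (a - m, b - m) \<noteq> 0"
      using Cons.prems(5) entry by (auto split: if_splits)
    have "\<exists>i < length Bs. drop m vs ! (a - m) \<in> similarity_part (drop m vs) Bs i \<and>
        drop m vs ! (b - m) \<in> similarity_part (drop m vs) Bs i"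
      using Cons.prems len nz False b by (intro Cons.IH) auto
    then obtain i where "i < length Bs" "vs ! a \<in> similarity_part (drop m vs) Bs i"
        "vs ! b \<in> similarity_part (drop m vs) Bs i"
      using False b len by auto
    then show ?thesis
      by (intro exI[of _ "Suc i"]) (simp add: similarity_part_Cons m_def)
  qed
qed

section \<open>Rooted products over a partitioned vertex set\<close>

text \<open>The partition is carried by the index function \<open>c\<close>, which replaces the
  existential quantifiers over parts in \<open>rooted_product\<close>.\<close>

locale vertex_partition =
  fixes V :: "'a set" and l :: nat and P :: "nat \<Rightarrow> 'a set" and c :: "'a \<Rightarrow> nat"
    and H :: "nat \<Rightarrow> 'h pair_pre_digraph" and r :: "nat \<Rightarrow> 'h"
  assumes part_subset: "\<And>i. i < l \<Longrightarrow> P i \<subseteq> V"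
    and c_less: "\<And>v. v \<in> V \<Longrightarrow> c v < l"
    and part_iff: "\<And>v i. v \<in> V \<Longrightarrow> i < l \<Longrightarrow> v \<in> P i \<longleftrightarrow> i = c v"
    and rooted: "\<And>i. i < l \<Longrightarrow> rooted_graph (H i) (r i)"
    and finite_V: "finite V"
begin

text \<open>The vertex set of every \<open>prod_graph G\<close>; it does not mention
  \<open>G\<close>, so the two products share their index set.\<close>

definition W :: "('a \<times> 'h) set" where
  "W = (SIGMA v:V. pverts (H (c v)))"

abbreviation prod_graph :: "'a pair_pre_digraph \<Rightarrow> ('a \<times> 'h) pair_pre_digraph" where
  "prod_graph G \<equiv> rooted_product G l P H r"

lemma mem_part_iff: "i < l \<and> v \<in> P i \<longleftrightarrow> v \<in> V \<and> i = c v"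
  using part_iff c_less part_subset by blast

lemma H_graph: "v \<in> V \<Longrightarrow> pair_graph (H (c v))"
  and root_in: "v \<in> V \<Longrightarrow> r (c v) \<in> pverts (H (c v))"
  using rooted c_less by (auto simp: rooted_graph_def)

lemma finite_H: "v \<in> V \<Longrightarrow> finite (pverts (H (c v)))"
  using H_graph pair_fin_digraph.pair_finite_verts
  by (auto simp: pair_graph_def pair_digraph_def)

lemma finite_W: "finite W"
  unfolding W_def using finite_V finite_H by (intro finite_SigmaI) auto

lemma pverts_prod: "pverts (prod_graph G) = W"
proof -
  have "pverts (prod_graph G) = {(v, x) | v x i. (i < l \<and> v \<in> P i) \<and> x \<in> pverts (H i)}"
    by (auto simp: rooted_product_def)
  also have "\<dots> = W"
    unfolding mem_part_iff W_def by auto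
  finally show ?thesis .
qed

lemma parcs_prod:
  assumes "v \<in> V"
  shows "((v, x), (w, y)) \<in> parcs (prod_graph G) \<longleftrightarrow>
    (w \<in> V \<and> x = r (c v) \<and> y = r (c w) \<and> (v, w) \<in> parcs G) \<or>
    (v = w \<and> (x, y) \<in> parcs (H (c v)))"
proof -
  have "((v, x), (w, y)) \<in> parcs (prod_graph G) \<longleftrightarrow>
    (\<exists>i j. (i < l \<and> v \<in> P i) \<and> (j < l \<and> w \<in> P j) \<and> x = r i \<and> y = r j \<and> (v, w) \<in> parcs G) \<or>
    (\<exists>i. (i < l \<and> v \<in> P i) \<and> v = w \<and> (x, y) \<in> parcs (H i))"
    unfolding rooted_product_def by auto
  then show ?thesis unfolding mem_part_iff using assms by blast
qed

text \<open>An arc leaving \<open>(v, x)\<close> either stays in the copy at \<open>v\<close> or, if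
  \<open>x\<close> is the root, follows an arc of \<open>G\<close>. As \<open>G\<close> has no
  loops, the latter leaves the copy, so nothing is counted twice.\<close>

lemma out_degree_prod:
  assumes "pair_graph G" "pverts G = V" "v \<in> V"
  shows "out_degree (with_proj (prod_graph G)) (v, x) =
    out_degree (with_proj (H (c v))) x + (if x = r (c v) then out_degree (with_proj G) v else 0)"
proof -
  interpret G: pair_graph G by fact
  interpret H: pair_graph "H (c v)" using assms(3) by (rule H_graph)
  have arcV: "w \<in> V" if "(u, w) \<in> parcs G" for u w
    using G.arc_snd_in_verts[OF that] assms(2) by simp
  have loop: "(u, u) \<notin> parcs G" for u
    using G.pair_no_loops[of "(u, u)"] by auto
  let ?A = "{e \<in> parcs (H (c v)). fst e = x}"
  let ?B = "if x = r (c v) then {e \<in> parcs G. fst e = v} else {}"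
  \<comment> \<open>\<open>?f\<close> embeds arcs of the attached graph into the copy at
    \<open>v\<close>, \<open>?g\<close> lifts arcs of \<open>G\<close> to roots. Both are injective
    here because the source of \<open>e\<close> is fixed.\<close>
  let ?f = "\<lambda>e. ((v, x), (v, snd e))"
  let ?g = "\<lambda>e. ((v, x), (snd e, r (c (snd e))))"
  have "{e \<in> parcs (prod_graph G). fst e = (v, x)} = ?f ` ?A \<union> ?g ` ?B"
    using parcs_prod[OF assms(3)] arcV by (auto simp: image_iff)
  moreover have "card (?f ` ?A \<union> ?g ` ?B) = card (?f ` ?A) + card (?g ` ?B)"
    by (rule card_Un_disjoint) (auto simp: loop)
  moreover have "card (?f ` ?A) = card ?A" "card (?g ` ?B) = card ?B"
    by (auto intro!: card_image inj_onI)
  ultimately show ?thesis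
    by (simp add: out_degree_def out_arcs_def)
qed

text \<open>Degrees add at a root, so the splitting holds on the diagonal for every
  \<open>q\<close>; off the diagonal an arc lies in one copy or joins the roots of two different
  copies.\<close>

lemma lap_prod:
  assumes "pair_graph G" "pverts G = V" "v \<in> V" "w \<in> V"
  shows "lap q (prod_graph G) (v, x) (w, y) =
    (if v = w then lap q (H (c v)) x y else 0) +
    (if x = r (c v) \<and> y = r (c w) then lap q G v w else 0)"
proof -
  have "(v, v) \<notin> parcs G"
    using pair_loopfree_digraph.pair_no_loops[of G "(v, v)"] assms(1)
    by (auto simp: pair_graph_def pair_digraph_def)
  then show ?thesis
    using assms(3,4)
    by (auto simp: lap_def out_degree_prod[OF assms(1,2)] parcs_prod algebra_simps)
qed

text \<open>No term is lost: \<open>S u \<noteq> 0\<close> forces \<open>c u = c v\<close>, hence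
  \<open>x\<close> is also a vertex of the copy at \<open>u\<close>.\<close>

lemma sum_W_row:
  assumes "\<And>u. u \<in> V \<Longrightarrow> S u \<noteq> 0 \<Longrightarrow> c u = c v" "x \<in> pverts (H (c v))"
  shows "(\<Sum>p\<in>W. (if snd p = x then S (fst p) else 0) * g p) = (\<Sum>u\<in>V. S u * g (u, x) :: complex)"
proof -
  have "(\<Sum>p\<in>W. (if snd p = x then S (fst p) else 0) * g p) =
      (\<Sum>u\<in>V. \<Sum>z\<in>pverts (H (c u)). (if z = x then S u else 0) * g (u, z))"
    unfolding W_def using finite_V finite_H by (subst sum.Sigma) (auto simp: case_prod_unfold)
  also have "\<dots> = (\<Sum>u\<in>V. S u * g (u, x))"
  proof (rule sum.cong[OF refl])
    fix u assume u: "u \<in> V"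
    have "(\<Sum>z\<in>pverts (H (c u)). (if z = x then S u else 0) * g (u, z)) =
        (\<Sum>z\<in>pverts (H (c u)). if z = x then S u * g (u, x) else 0)"
      by (rule sum.cong) auto
    also have "\<dots> = S u * g (u, x)"
      using assms(1)[OF u] assms(2) finite_H[OF u] by (cases "S u = 0") auto
    finally show "(\<Sum>z\<in>pverts (H (c u)). (if z = x then S u else 0) * g (u, z)) = S u * g (u, x)" .
  qed
  finally show ?thesis .
qed

theorem cospectral_rooted_products:
  assumes G: "pair_graph G" "pverts G = V" and G': "pair_graph G'" "pverts G' = V"
    and comm: "\<And>u w. u \<in> V \<Longrightarrow> w \<in> V \<Longrightarrow>
           (\<Sum>v\<in>V. S u v * lap q G v w) = (\<Sum>v\<in>V. lap q G' u v * S v w)"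
    and inv: "\<And>u w. u \<in> V \<Longrightarrow> w \<in> V \<Longrightarrow> (\<Sum>v\<in>V. S u v * T v w) = (if u = w then 1 else 0)"
    and block: "\<And>u w. u \<in> V \<Longrightarrow> w \<in> V \<Longrightarrow> S u w \<noteq> 0 \<Longrightarrow> c u = c w"
  shows "cospectral q (prod_graph G) (prod_graph G')"
proof (rule cospectral_intertwining[OF finite_W pverts_prod pverts_prod])
  let ?S = "\<lambda>p s. if snd s = snd p then S (fst p) (fst s) else 0"
  \<comment> \<open>The condition on \<open>c\<close> makes it unnecessary to know that \<open>T\<close> is block diagonal.\<close>
  let ?T = "\<lambda>p s. if snd p = snd s \<and> c (fst p) = c (fst s) then T (fst p) (fst s) else 0"
  fix p s assume "p \<in> W" "s \<in> W"
  then obtain v x w y where ps: "p = (v, x)" "s = (w, y)" and v: "v \<in> V" "x \<in> pverts (H (c v))"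
    and w: "w \<in> V" "y \<in> pverts (H (c w))"
    by (auto simp: W_def)
  \<comment> \<open>In every nonzero term below, \<open>c u\<close> may be replaced by
    \<open>c v\<close> in a row sum and by \<open>c w\<close> in a column sum.\<close>
  have zero_row: "S v u = 0 \<or> c u = c v" and zero_col: "S u w = 0 \<or> c u = c w"
    if "u \<in> V" for u
    using block[OF v(1) that] block[OF that w(1)] by fastforce+
  have row: "(\<Sum>p'\<in>W. ?S p p' * g p') = (\<Sum>u\<in>V. S v u * g (u, x))" for g
    unfolding ps fst_conv snd_conv using v block by (intro sum_W_row) (auto dest: sym)
  \<comment> \<open>Column sums are row sums for the function
    \<open>\<lambda>u. S u w\<close>.\<close>
  have "(\<Sum>p'\<in>W. (if snd p' = y then S (fst p') w else 0) * g p') = (\<Sum>u\<in>V. S u w * g (u, y))" for g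
    using w block by (intro sum_W_row) auto
  then have col: "(\<Sum>p'\<in>W. g p' * ?S p' s) = (\<Sum>u\<in>V. g (u, y) * S u w)" for g
    unfolding ps fst_conv snd_conv by (simp only: mult.commute[of "g _"] eq_commute[of y])
  have "(\<Sum>p'\<in>W. ?S p p' * lap q (prod_graph G) p' s) =
      (\<Sum>u\<in>V. S v u * lap q (prod_graph G) (u, x) s)"
    by (rule row)
  \<comment> \<open>By \<open>lap_prod\<close>, the copy part contributes only at
    \<open>u = w\<close>; the sum that remains is the part on the roots.\<close>
  also have "\<dots> = S v w * lap q (H (c w)) x y +
      (\<Sum>u\<in>V. S v u * (if x = r (c u) \<and> y = r (c w) then lap q G u w else 0))"
    using v w finite_V
    by (simp add: ps lap_prod[OF G] distrib_left sum.distrib if_distrib[of "\<lambda>x. _ * x"]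
        cong: if_cong)
  \<comment> \<open>Where \<open>S v u\<close> is nonzero, \<open>r (c u) = r (c v)\<close>: the
    root test no longer depends on \<open>u\<close> and leaves the sum.\<close>
  also have "(\<Sum>u\<in>V. S v u * (if x = r (c u) \<and> y = r (c w) then lap q G u w else 0)) =
      (if x = r (c v) \<and> y = r (c w) then \<Sum>u\<in>V. S v u * lap q G u w else 0)"
    by (auto intro!: sum.cong sum.neutral dest: zero_row)
  also have "(\<Sum>u\<in>V. S v u * lap q G u w) = (\<Sum>u\<in>V. lap q G' v u * S u w)"
    using v w by (intro comm)
  \<comment> \<open>Conversely the root test reenters the sum, with \<open>c u\<close> in place of
    \<open>c w\<close>.\<close>
  also have "(if x = r (c v) \<and> y = r (c w) then \<Sum>u\<in>V. lap q G' v u * S u w else 0) =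
      (\<Sum>u\<in>V. (if x = r (c v) \<and> y = r (c u) then lap q G' v u else 0) * S u w)"
    by (rule sym) (auto intro!: sum.cong sum.neutral dest: zero_col)
  \<comment> \<open>If \<open>S v w\<close> is nonzero, \<open>v\<close> and \<open>w\<close> carry
    the same attached graph.\<close>
  also have "S v w * lap q (H (c w)) x y = lap q (H (c v)) x y * S v w"
    using block[OF v(1) w(1)] by (cases "S v w = 0") auto
  also have "lap q (H (c v)) x y * S v w +
      (\<Sum>u\<in>V. (if x = r (c v) \<and> y = r (c u) then lap q G' v u else 0) * S u w) =
      (\<Sum>u\<in>V. lap q (prod_graph G') p (u, y) * S u w)"
    using v w finite_V
    by (simp add: ps lap_prod[OF G'] distrib_right sum.distrib if_distrib[of "\<lambda>x. x * _"]
        cong: if_cong)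
  also have "\<dots> = (\<Sum>p'\<in>W. lap q (prod_graph G') p p' * ?S p' s)"
    by (rule col[symmetric])
  finally show "(\<Sum>p'\<in>W. ?S p p' * lap q (prod_graph G) p' s) =
      (\<Sum>p'\<in>W. lap q (prod_graph G') p p' * ?S p' s)" .
  have "(\<Sum>p'\<in>W. ?S p p' * ?T p' s) =
      (\<Sum>u\<in>V. S v u * ?T (u, x) s)"
    by (rule row)
  also have "\<dots> = (\<Sum>u\<in>V. S v u * (if x = y \<and> c u = c w then T u w else 0))"
    by (simp add: ps cong: if_cong)
  \<comment> \<open>Again \<open>c u = c v\<close> in nonzero terms, so the test built into
    \<open>?T\<close> is constant along the sum.\<close>
  also have "\<dots> = (if x = y \<and> c v = c w then \<Sum>u\<in>V. S v u * T u w else 0)"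
    by (auto intro!: sum.cong sum.neutral dest: zero_row)
  also have "\<dots> = (if p = s then 1 else 0)"
    using inv[OF v(1) w(1)] by (auto simp: ps)
  finally show "(\<Sum>p'\<in>W. ?S p p' * ?T p' s) = (if p = s then 1 else 0)" .
qed

end

section \<open>From the block diagonal matrix to the vertex partition\<close>

theorem theorem3p2:
  fixes q :: real and vs :: "'a list" and G1 G2 :: "'a pair_pre_digraph"
    and Bs :: "complex mat list" and Sinv :: "complex mat"
    and H :: "nat \<Rightarrow> 'h pair_pre_digraph" and r :: "nat \<Rightarrow> 'h"
  assumes "pair_graph G1" and "pair_graph G2"
    and "enumerates vs (pverts G1)" and "enumerates vs (pverts G2)"
    and "\<And>B. B \<in> set Bs \<Longrightarrow> square_mat B"
    and "similar_mat_wit (q_laplacian q vs G2) (q_laplacian q vs G1) (diag_block_mat Bs) Sinv"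
    and "\<And>i. i < length Bs \<Longrightarrow> rooted_graph (H i) (r i)"
  shows "cospectral q (rooted_product G1 (length Bs) (similarity_part vs Bs) H r)
                      (rooted_product G2 (length Bs) (similarity_part vs Bs) H r)"
proof -
  define n where "n = length vs"
  have vs: "distinct vs" "pverts G1 = set vs" "pverts G2 = set vs"
    using assms(3,4) by (auto simp: enumerates_def)
  let ?L1 = "list_mat vs (lap q G1)" and ?L2 = "list_mat vs (lap q G2)"
  let ?D = "diag_block_mat Bs"
  have L2: "?L2 \<in> carrier_mat n n"
    by (simp add: n_def)
  have wit: "similar_mat_wit ?L2 ?L1 ?D Sinv"
    using assms(6) vs(1) by (simp add: q_laplacian_eq_list_mat)
  note sim = similar_mat_witD2[OF L2 wit]
  \<comment> \<open>The block sizes add up to the number of vertices because the similarity matrix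
    has the size of the Laplacians.\<close>
  have len: "length vs = sum_list (map dim_row Bs)"
    using sim(6) dim_diag_block_mat(1)[of Bs] by (simp add: n_def)
  \<comment> \<open>Multiplying \<open>?L2 = ?D * ?L1 * Sinv\<close> by \<open>?D\<close> on the
    right cancels \<open>Sinv\<close> and leaves the intertwining relation.\<close>
  have "?L2 * ?D = ?D * ?L1 * (Sinv * ?D)"
    unfolding sim(3) using sim(5-7) by (intro assoc_mult_mat) auto
  then have DL: "?D * ?L1 = ?L2 * ?D"
    using sim by simp
  obtain S where S: "?D = list_mat vs S"
    using sim(6) vs(1) list_mat_exists unfolding n_def by blast
  obtain T where T: "Sinv = list_mat vs T"
    using sim(7) vs(1) list_mat_exists unfolding n_def by blast
  have comm: "(\<Sum>v\<in>set vs. S u v * lap q G1 v w) = (\<Sum>v\<in>set vs. lap q G2 u v * S v w)"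
    if "u \<in> set vs" "w \<in> set vs" for u w
    using DL that vs(1) by (simp add: S list_mat_mult list_mat_eq_iff)
  have inv: "(\<Sum>v\<in>set vs. S u v * T v w) = (if u = w then 1 else 0)"
    if "u \<in> set vs" "w \<in> set vs" for u w
    using sim(1) that vs(1) by (simp add: S T n_def list_mat_one list_mat_mult list_mat_eq_iff)
  \<comment> \<open>The description is proper on \<open>set vs\<close>, where exactly one part
    contains \<open>v\<close>.\<close>
  define c where "c v = (THE i. i < length Bs \<and> v \<in> similarity_part vs Bs i)" for v
  have c: "i < length Bs \<and> v \<in> similarity_part vs Bs i \<longleftrightarrow> i = c v" if "v \<in> set vs" for v i
    using similarity_part_partition[OF vs(1) len that] unfolding c_def
    by (metis (mono_tags, lifting) theI')
  have block: "c u = c w" if uw: "u \<in> set vs" "w \<in> set vs" and "S u w \<noteq> 0" for u w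
  proof -
    obtain a b where ab: "a < length vs" "b < length vs" "u = vs ! a" "w = vs ! b"
      using uw by (metis in_set_conv_nth)
    then have "?D $$ (a, b) \<noteq> 0"
      using \<open>S u w \<noteq> 0\<close> by (simp add: S list_mat_def)
    then show ?thesis
      using diag_block_mat_nonzero_same_part[OF assms(5) len ab(1,2)] c uw ab(3,4) by metis
  qed
  interpret vertex_partition "set vs" "length Bs" "similarity_part vs Bs" c H r
  proof
    show "similarity_part vs Bs i \<subseteq> set vs" for i
      by (rule similarity_part_subset)
    show "v \<in> similarity_part vs Bs i \<longleftrightarrow> i = c v" if "v \<in> set vs" "i < length Bs" for v i
      using c[OF that(1)] that(2) by blast
  qed (use c assms(7) in auto)
  show ?thesis
    using assms(1,2) vs(2,3) comm inv block by (intro cospectral_rooted_products)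
qed

end
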